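(* Let $m\ge3$ and let $x_1,\dotsc,x_{m-2}$ be odd positive integers such that $x_k>B(x_i,\dots,x_{k-1})$ for all positive integers $i<k\le m-2$, where for odd positive integers $z_1,\dots,z_r$ ($r\ge1$) \[ B(z_1,\dots,z_r)=\frac{(z_1-2)z_1\cdots z_r}{2\sigma_{r-1}(z_1,\dotsc,z_r)-z_1^2\sigma_{r-2}(z_2,\dotsc,z_r)}. \] Let $c_1$ be a nonnegative integer such that $\frac{x_{m-2}^2+3}{2}-x_{m-2}+2c_1>B(x_i,\dots,x_{m-2})$ for all $i\in\{1,\dots,m-3\}$, let $b=\frac{x_{m-2}^2+3}{2}-x_{m-2}+2c_1$, and let $c_2$ be a nonnegative integer such that $\frac{b^2+3}{2}-b+2c_2>B(x_i,\dots,x_{m-2},b)$ for all $i\in\{1,\dots,m-2\}$. Then for all nonnegative integers $t_1,t_2$, setting $x_{m-1}=b+2t_1$ and $x_m=\frac{x_{m-1}^2+3}{2}-x_{m-1}+2c_2+2t_2$, the rational number \[ \frac{\sigma_{m-1}(x_1,\dotsc,x_m)}{x_1\cdots x_m}=\sum_{j=1}^m\frac1{x_j} \] has odd greedy expansion of length $m$ with denominators $x_1,\dotsc,x_m$.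
   Context: $\sigma_k(y_1,\dots,y_r)$ denotes the elementary symmetric polynomial of degree $k$; $\sigma_0=1$ (also for an empty list), $\sigma_k=0$ for $k<0$. Odd greedy expansion: given a positive rational $q$, define $x_1,x_2,\dots$ recursively: writing $R_i=q-\sum_{j=1}^{i-1}1/x_j$, if $R_i\ge1$ let $x_i=1$, and if $0<R_i<1$ let $x_i$ be the unique odd positive integer with $\frac1{x_i}\le R_i<\frac1{x_i-2}$; stop when the remainder is $0$. The $x_i$ are the denominators, and the number of terms is the length. *)

theory Defs
  imports Complex_Main
begin

text \<open>For negative \<open>k\<close> the index set is empty and the value is \<open>0\<close>; for \<open>k = 0\<close> only
  the empty index set contributes, also for the empty list, and the value is \<open>1\<close>.\<close>

definition esym :: "int \<Rightarrow> int list \<Rightarrow> int" where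
  "esym k ys = (\<Sum>I | I \<subseteq> {..<length ys} \<and> int (card I) = k. \<Prod>i\<in>I. ys ! i)"

text \<open>Only used for nonempty lists, where \<open>hd zs\<close> is $z_1$ and \<open>tl zs\<close> is $z_2,\dots,z_r$.\<close>

definition B :: "int list \<Rightarrow> rat" where
  "B zs = of_int ((hd zs - 2) * prod_list zs) /
     of_int (2 * esym (int (length zs) - 1) zs
             - (hd zs)\<^sup>2 * esym (int (length zs) - 2) (tl zs))"

definition odd_greedy_choice :: "rat \<Rightarrow> int \<Rightarrow> bool" where
  "odd_greedy_choice R d \<longleftrightarrow>
     (R \<ge> 1 \<and> d = 1) \<or>
     (0 < R \<and> R < 1 \<and> odd d \<and> d > 0 \<and> 1 / of_int d \<le> R \<and> R < 1 / of_int (d - 2))"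

lemma odd_greedy_choice_ex1:
  assumes "R > 0"
  shows "\<exists>!d. odd_greedy_choice R d"
proof (cases "R \<ge> 1")
  case True
  then show ?thesis by (auto simp: odd_greedy_choice_def)
next
  case False
  have char: "odd_greedy_choice R d \<longleftrightarrow> odd d \<and> 1 / R \<le> of_int d \<and> of_int d < 1 / R + 2" for d
  proof
    assume "odd_greedy_choice R d"
    then have d: "odd d" "d > 0" "1 / of_int d \<le> R" "R < 1 / of_int (d - 2)"
      using False by (auto simp: odd_greedy_choice_def)
    have "of_int (d - 2) > (0::rat)"
      using d(4) assms by (metis less_trans zero_less_divide_1_iff)
    with d assms show "odd d \<and> 1 / R \<le> of_int d \<and> of_int d < 1 / R + 2"
      by (simp add: field_simps)
  next
    assume a: "odd d \<and> 1 / R \<le> of_int d \<and> of_int d < 1 / R + 2"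
    have "1 / R > 1" using False assms by simp
    then have "of_int d > (1::rat)" using a by linarith
    then have "d > 1" by simp
    moreover have "d \<noteq> 2" using a by auto
    ultimately have "d > 2" by linarith
    then have "of_int d > (2::rat)" by simp
    with a \<open>d > 2\<close> False assms show "odd_greedy_choice R d"
      by (simp add: odd_greedy_choice_def field_simps)
  qed
  define c where "c = \<lceil>1 / R\<rceil>"
  have c: "of_int c - 1 < 1 / R" "1 / R \<le> of_int c"
    unfolding c_def by linarith+
  define d where "d = (if odd c then c else c + 1)"
  show ?thesis
  proof (rule ex1I[of _ d])
    show "odd_greedy_choice R d"
      unfolding char using c by (auto simp: d_def)
  next
    fix e assume "odd_greedy_choice R e"
    then have e: "odd e" "1 / R \<le> of_int e" "of_int e < 1 / R + 2"
      unfolding char by auto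
    have "of_int c < (of_int e + 1 :: rat)" "of_int e < (of_int c + 2 :: rat)"
      using c e by linarith+
    then have "c \<le> e" "e < c + 2" by linarith+
    with e(1) show "e = d" by (cases "e = c") (auto simp: d_def, presburger+)
  qed
qed

text \<open>The terminating expansion: \<open>q - (\<Sum>j<i. 1 / xs ! j)\<close> is the remainder before the
  (zero-based) \<open>i\<close>-th denominator is chosen; a choice is possible only if it is positive, and
  the process stops after the last denominator.\<close>

definition has_odd_greedy_expansion :: "rat \<Rightarrow> int list \<Rightarrow> bool" where
  "has_odd_greedy_expansion q xs \<longleftrightarrow>
     q > 0 \<and>
     (\<forall>i<length xs. odd_greedy_choice (q - (\<Sum>j<i. 1 / of_int (xs ! j))) (xs ! i)) \<and>
     q - (\<Sum>j<length xs. 1 / of_int (xs ! j)) = 0"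

text \<open>The division is exact for odd \<open>y\<close>, the only case in which it is used.\<close>

definition next_base :: "int \<Rightarrow> int" where
  "next_base y = (y\<^sup>2 + 3) div 2 - y"

lemma of_int_next_base:
  assumes "odd y"
  shows "(of_int (next_base y) :: rat) = ((of_int y)\<^sup>2 + 3) / 2 - of_int y"
proof -
  have "even (y\<^sup>2 + 3)" using assms by simp
  then obtain k where "y\<^sup>2 + 3 = 2 * k" by (elim evenE)
  moreover from this have "(of_int y)\<^sup>2 + 3 = (2 * of_int k :: rat)"
    by (metis of_int_add of_int_mult of_int_numeral of_int_power)
  ultimately show ?thesis by (simp add: next_base_def)
qed

lemma odd_next_base:
  assumes "odd y"
  shows "odd (next_base y)"
proof -
  obtain k where "y = 2 * k + 1" using assms by (elim oddE)
  then have "y\<^sup>2 + 3 = 2 * (2 * (k\<^sup>2 + k + 1))" by (simp add: power2_eq_square algebra_simps)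
  then show ?thesis using assms by (simp add: next_base_def)
qed

end

theory Submission
  imports Defs
begin

text \<open>Dividing numerator and denominator by $z_1\cdots z_r$ gives
  $B(z_1,\dots,z_r) = (z_1-2)/(2/z_1-(z_1-2)T)$ with $T=\sum_{j\ge2}1/z_j$. Hence, as long as
  $T<2/(z_1(z_1-2))$, the inequality $y>B(z_1,\dots,z_r)$ says exactly that this bound survives
  adding $1/y$ to $T$. The bound itself is equivalent to $1/z_1+T<1/(z_1-2)$, which is the
  maximality condition in the greedy choice of $z_1$. For the last two denominators,
  $(y^2+3)/2-y>y(y-2)/2$ starts the bound, and passing from $b$ to a larger $x_{m-1}$ only
  decreases the tails.\<close>

section \<open>Elementary symmetric polynomials and \<open>B\<close> in terms of sums of
  reciprocals\<close>

text \<open>The index sets with one element fewer than the whole are the complements of singletons.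
  For the empty list the degree is -1 and both sides are 0.\<close>

lemma esym_length_minus_one:
  "esym (int (length ys) - 1) ys = (\<Sum>i<length ys. \<Prod>j\<in>{..<length ys} - {i}. ys ! j)"
proof -
  let ?n = "length ys"
  have "bij_betw (\<lambda>i. {..<?n} - {i}) {..<?n} {I. I \<subseteq> {..<?n} \<and> int (card I) = int ?n - 1}"
  proof (rule bij_betw_imageI)
    show "inj_on (\<lambda>i. {..<?n} - {i}) {..<?n}"
      by (auto simp: inj_on_def)
    show "(\<lambda>i. {..<?n} - {i}) ` {..<?n} = {I. I \<subseteq> {..<?n} \<and> int (card I) = int ?n - 1}"
    proof (intro equalityI subsetI)
      fix I assume "I \<in> {I. I \<subseteq> {..<?n} \<and> int (card I) = int ?n - 1}"
      then have I: "I \<subseteq> {..<?n}" "int (card I) = int ?n - 1" by auto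
      have "card ({..<?n} - I) = ?n - card I"
        using I(1) by (simp add: card_Diff_subset finite_subset)
      then have "card ({..<?n} - I) = 1" using I(2) by linarith
      then obtain i where "{..<?n} - I = {i}" by (auto simp: card_1_singleton_iff)
      then have "i \<in> {..<?n}" "I = {..<?n} - {i}" using I(1) by blast+
      then show "I \<in> (\<lambda>i. {..<?n} - {i}) ` {..<?n}" by blast
    qed (auto simp: card_Diff_subset)
  qed
  from sum.reindex_bij_betw[OF this, of "\<lambda>I. \<Prod>j\<in>I. ys ! j"]
  show ?thesis by (simp add: esym_def)
qed

text \<open>Omitting one nonzero factor from the product amounts to dividing by it. The empty list
  is included because the tail of a one-element argument of \<open>B\<close> is empty.\<close>

lemma of_int_esym_length_minus_one:
  assumes "0 \<notin> set ys"
  shows "(of_int (esym (int (length ys) - 1) ys) :: 'a :: field_char_0)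
       = of_int (prod_list ys) * (\<Sum>y\<leftarrow>ys. 1 / of_int y)"
proof -
  let ?n = "length ys"
  have P: "prod_list ys = (\<Prod>j<?n. ys ! j)"
    by (simp add: prod.list_conv_set_nth atLeast0LessThan)
  have "(of_int (\<Prod>j\<in>{..<?n} - {i}. ys ! j) :: 'a) = of_int (prod_list ys) * (1 / of_int (ys ! i))"
    if "i < ?n" for i
  proof -
    have "prod_list ys = ys ! i * (\<Prod>j\<in>{..<?n} - {i}. ys ! j)"
      unfolding P using that by (subst prod.remove[of _ i]) auto
    moreover have "ys ! i \<noteq> 0" using assms that by (metis nth_mem)
    ultimately show ?thesis by (simp del: of_int_prod)
  qed
  then show ?thesis
    by (simp add: esym_length_minus_one sum_list_sum_nth atLeast0LessThan sum_distrib_left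
        del: of_int_prod)
qed

lemma B_Cons:
  assumes "z \<noteq> 0" "0 \<notin> set zs"
  shows "B (z # zs)
       = (of_int z - 2) / (2 / of_int z - (of_int z - 2) * (\<Sum>y\<leftarrow>zs. 1 / of_int y))"
proof -
  define T :: rat where "T = (\<Sum>y\<leftarrow>zs. 1 / of_int y)"
  define P :: rat where "P = of_int (prod_list zs)"
  define Z :: rat where "Z = of_int z"
  have nz: "Z \<noteq> 0" "P \<noteq> 0" using assms by (auto simp: Z_def P_def prod_list_zero_iff)
  have e1: "of_int (esym (int (length zs)) (z # zs)) = Z * P * (1 / Z + T)"
    using of_int_esym_length_minus_one[of "z # zs", where 'a = rat] assms
    by (simp add: Z_def P_def T_def)
  have e2: "of_int (esym (int (length zs) - 1) zs) = P * T"
    using of_int_esym_length_minus_one[of zs, where 'a = rat] assms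
    by (simp add: P_def T_def)
  have "B (z # zs) = ((Z - 2) * (Z * P)) / (2 * (Z * P * (1 / Z + T)) - Z\<^sup>2 * (P * T))"
    by (simp add: B_def e1 e2 flip: Z_def P_def)
  also have "2 * (Z * P * (1 / Z + T)) - Z\<^sup>2 * (P * T) = (2 / Z - (Z - 2) * T) * (Z * P)"
    using nz by (simp add: field_simps power2_eq_square)
  \<comment> \<open>Cancelling \<open>Z * P\<close> is sound even if the remaining denominator
    vanishes: both quotients are then 0.\<close>
  also have "((Z - 2) * (Z * P)) / \<dots> = (Z - 2) / (2 / Z - (Z - 2) * T)"
    using nz by simp
  finally show ?thesis by (simp add: Z_def T_def)
qed

section \<open>Tail bounds and the greedy choice\<close>

text \<open>The room left below the bound is \<open>D / (Z - 2)\<close>, the reciprocal of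
  \<open>B (z # zs)\<close>. The bound for the old tail makes this room positive, so
  \<open>B (z # zs) < y\<close> can be inverted and says that \<open>1 / y\<close> fits into
  it.\<close>

lemma tail_bound_extend:
  fixes y :: rat
  assumes "z \<ge> 3" "0 \<notin> set zs" "y > 0" "B (z # zs) < y"
    and "(\<Sum>u\<leftarrow>zs. 1 / of_int u) < 2 / (of_int z * (of_int z - 2 :: rat))"
  shows "(\<Sum>u\<leftarrow>zs. 1 / of_int u) + 1 / y < 2 / (of_int z * (of_int z - 2))"
proof -
  define T :: rat where "T = (\<Sum>u\<leftarrow>zs. 1 / of_int u)"
  define Z :: rat where "Z = of_int z"
  have Z: "Z \<ge> 3" using assms(1) by (simp add: Z_def)
  define D where "D = 2 / Z - (Z - 2) * T"
  have D: "D / (Z - 2) = 2 / (Z * (Z - 2)) - T"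
    using Z by (simp add: D_def diff_divide_distrib)
  moreover have "2 / (Z * (Z - 2)) - T > 0" using assms(5) by (simp add: T_def Z_def)
  ultimately have "D / (Z - 2) > 0" by simp
  then have "D > 0" using Z by (simp add: zero_less_divide_iff)
  have "(Z - 2) / D < y"
    using assms(1,2,4) B_Cons[of z zs] by (simp add: D_def T_def Z_def)
  then have "1 / y < D / (Z - 2)"
    using \<open>D > 0\<close> Z assms(3) by (simp add: field_simps)
  then show ?thesis using D by (simp add: T_def Z_def)
qed

text \<open>Since \<open>1 / z + 2 / (z * (z - 2)) = 1 / (z - 2)\<close>, the bound on
  \<open>T\<close> gives the strict upper condition, and \<open>T \<ge> 0\<close> gives the lower
  one. For \<open>z = 1\<close> the remainder is at least 1, which forces the choice; hence the
  bound is asked for only from 3 on.\<close>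

lemma odd_greedy_choice_add_tail:
  assumes "odd z" "z > 0" "T \<ge> 0"
    and "z \<ge> 3 \<Longrightarrow> T < 2 / (of_int z * (of_int z - 2))"
  shows "odd_greedy_choice (1 / of_int z + T) z"
proof (cases "z = 1")
  case True
  then show ?thesis using assms(3) by (simp add: odd_greedy_choice_def)
next
  case False
  moreover have "z \<noteq> 2" using assms(1) by auto
  ultimately have z: "z \<ge> 3" using assms(2) by linarith
  define Z :: rat where "Z = of_int z"
  have Z: "Z \<ge> 3" using z by (simp add: Z_def)
  have "T < 2 / (Z * (Z - 2))" using assms(4)[OF z] by (simp add: Z_def)
  moreover have "1 / Z + 2 / (Z * (Z - 2)) = 1 / (Z - 2)" using Z by (simp add: field_simps)
  ultimately have less: "1 / Z + T < 1 / (Z - 2)" by linarith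
  also have "\<dots> \<le> 1" using Z by simp
  finally have "1 / Z + T < 1" .
  moreover have "1 / Z + T > 0" using Z assms(3) by (simp add: add_pos_nonneg)
  ultimately show ?thesis using less assms(1-3)
    by (auto simp: odd_greedy_choice_def Z_def)
qed

text \<open>The remainder before a denominator is chosen is its reciprocal plus the tail after it,
  so the greedy condition can be checked at each index separately.\<close>

lemma has_odd_greedy_expansion_if_tail_bounds:
  fixes x :: "nat \<Rightarrow> int"
  assumes "m \<ge> 1"
    and pos: "\<And>k. 1 \<le> k \<Longrightarrow> k \<le> m \<Longrightarrow> odd (x k) \<and> x k > 0"
    and tail: "\<And>i. 1 \<le> i \<Longrightarrow> i \<le> m \<Longrightarrow> x i \<ge> 3 \<Longrightarrow>
      (\<Sum>j=Suc i..m. 1 / of_int (x j)) < 2 / (of_int (x i) * (of_int (x i) - 2 :: rat))"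
  shows "has_odd_greedy_expansion (\<Sum>j=1..m. 1 / of_int (x j)) (map x [1..<m + 1])"
proof -
  let ?f = "\<lambda>j. 1 / of_int (x j) :: rat"
  define xs where "xs = map x [1..<m + 1]"
  have xs: "length xs = m" "\<And>i. i < m \<Longrightarrow> xs ! i = x (Suc i)"
    by (auto simp: xs_def simp del: upt_Suc)
  have shift: "(\<Sum>j<i. 1 / of_int (xs ! j)) = sum ?f {1..i}" if "i \<le> m" for i
  proof -
    have "(\<Sum>j<i. 1 / of_int (xs ! j)) = (\<Sum>j<i. ?f (Suc j))"
      using that by (intro sum.cong) (auto simp: xs)
    also have "\<dots> = sum ?f {1..i}"
      by (simp add: sum.atLeast1_atMost_eq)
    finally show ?thesis .
  qed
  have "odd_greedy_choice (sum ?f {1..m} - (\<Sum>j<i. 1 / of_int (xs ! j))) (xs ! i)"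
    if "i < m" for i
  proof -
    have "sum ?f {1..m} = sum ?f {1..i} + sum ?f {Suc i..m}"
      using that sum.ub_add_nat[of 1 i ?f "m - i"] by simp
    also have "sum ?f {Suc i..m} = ?f (Suc i) + sum ?f {Suc (Suc i)..m}"
      using that by (simp add: sum.atLeast_Suc_atMost)
    finally have "sum ?f {1..m} - sum ?f {1..i} = ?f (Suc i) + sum ?f {Suc (Suc i)..m}"
      by simp
    moreover have "sum ?f {Suc (Suc i)..m} \<ge> 0"
      using pos by (intro sum_nonneg) (auto simp: less_imp_le)
    ultimately show ?thesis
      using odd_greedy_choice_add_tail[of "x (Suc i)" "sum ?f {Suc (Suc i)..m}"]
        pos[of "Suc i"] tail[of "Suc i"] that shift[of i] xs(2)[of i] by auto
  qed
  moreover have "sum ?f {1..m} > 0"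
    using assms(1) pos by (intro sum_pos) auto
  ultimately show ?thesis
    unfolding has_odd_greedy_expansion_def xs_def[symmetric] xs(1) using shift[of m] by simp
qed

section \<open>Size and growth of \<open>next_base\<close>\<close>

text \<open>Rounding in \<open>div\<close> loses at most 1 after doubling, which lowers the constant
  3 to 2 for even \<open>y\<close>.\<close>

lemma next_base_ge: "2 * next_base y \<ge> y * (y - 2) + 2"
  by (simp add: next_base_def power2_eq_square algebra_simps)

lemma next_base_pos: "next_base y > 0"
proof -
  have "y * (y - 2) + 2 = (y - 1)\<^sup>2 + 1" by (simp add: power2_eq_square algebra_simps)
  then show ?thesis using next_base_ge[of y] zero_le_power2[of "y - 1"] by linarith
qed

text \<open>For odd \<open>y\<close>, twice \<open>next_base y\<close> is
  \<open>(y - 1)\<^sup>2 + 2\<close>, which is monotone from 1 on.\<close>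

lemma next_base_mono:
  assumes "1 \<le> y" "y \<le> z" "odd y" "odd z"
  shows "next_base y \<le> next_base z"
proof -
  have "(y - 1)\<^sup>2 \<le> (z - 1)\<^sup>2" using assms by (intro power_mono) auto
  then have "(of_int ((y - 1)\<^sup>2) :: rat) \<le> of_int ((z - 1)\<^sup>2)" by (simp only: of_int_le_iff)
  then have "(of_int (next_base y) :: rat) \<le> of_int (next_base z)"
    using assms by (simp add: of_int_next_base power2_eq_square field_simps)
  then show ?thesis by simp
qed

text \<open>The threshold \<open>y * (y - 2) / 2\<close> is \<open>B [y]\<close>, so a one-term tail
  starting at \<open>next_base y\<close> or later always satisfies the bound.\<close>

lemma tail_bound_next_base:
  assumes "y \<ge> 3" "z \<ge> next_base y"
  shows "1 / of_int z < 2 / (of_int y * (of_int y - 2) :: rat)"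
proof -
  have "y * (y - 2) < 2 * z" using next_base_ge[of y] assms(2) by linarith
  then have "(of_int (y * (y - 2)) :: rat) < of_int (2 * z)" by (simp only: of_int_less_iff)
  moreover have "z > 0" using next_base_pos[of y] assms(2) by linarith
  moreover have "of_int y * (of_int y - 2) > (0 :: rat)" using assms(1) by simp
  ultimately show ?thesis by (simp add: field_simps)
qed

text \<open>The empty tail satisfies the bound because its right-hand side is positive; each further
  term is added by \<open>tail_bound_extend\<close>.\<close>

lemma tail_bound_induct:
  fixes x :: "nat \<Rightarrow> int"
  assumes "x i \<ge> 3" "i < n"
    and "\<And>k. i < k \<Longrightarrow> k < n \<Longrightarrow> x k > 0"
    and "\<And>k. i < k \<Longrightarrow> k < n \<Longrightarrow> of_int (x k) > B (map x [i..<k])"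
  shows "(\<Sum>u\<leftarrow>map x [Suc i..<n]. 1 / of_int u) < 2 / (of_int (x i) * (of_int (x i) - 2 :: rat))"
proof -
  have "Suc i \<le> n" using assms(2) by simp
  then show ?thesis using assms(3,4)
  proof (induction n rule: dec_induct)
    case base
    then show ?case using assms(1) by simp
  next
    case (step n)
    have "0 \<notin> set (map x [Suc i..<n])"
    proof
      assume "0 \<in> set (map x [Suc i..<n])"
      then obtain k where "Suc i \<le> k" "k < n" "x k = 0" by auto
      then show False using step.prems(1)[of k] by simp
    qed
    moreover have "B (x i # map x [Suc i..<n]) < of_int (x n)"
      using step.prems(2)[of n] step.hyps by (simp add: upt_conv_Cons)
    moreover have "of_int (x n) > (0 :: rat)" using step.prems(1)[of n] step.hyps by simp
    ultimately have "(\<Sum>u\<leftarrow>map x [Suc i..<n]. 1 / of_int u) + 1 / of_int (x n)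
        < 2 / (of_int (x i) * (of_int (x i) - 2 :: rat))"
      using step assms(1) by (intro tail_bound_extend) auto
    then show ?case using step.hyps by simp
  qed
qed

section \<open>Tail bounds for all denominators, including the last two\<close>

theorem theorem5p2:
  fixes m :: nat and x :: "nat \<Rightarrow> int" and b :: int and c1 c2 t1 t2 :: nat
  assumes "m \<ge> 3"
    and "\<And>k. 1 \<le> k \<Longrightarrow> k \<le> m - 2 \<Longrightarrow> odd (x k) \<and> x k > 0"
    and "\<And>i k. 1 \<le> i \<Longrightarrow> i < k \<Longrightarrow> k \<le> m - 2 \<Longrightarrow> of_int (x k) > B (map x [i..<k])"
    and "\<And>i. 1 \<le> i \<Longrightarrow> i \<le> m - 3 \<Longrightarrow>
           of_int (next_base (x (m - 2)) + 2 * int c1) > B (map x [i..<m - 1])"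
    and "b = next_base (x (m - 2)) + 2 * int c1"
    and "\<And>i. 1 \<le> i \<Longrightarrow> i \<le> m - 2 \<Longrightarrow>
           of_int (next_base b + 2 * int c2) > B (map x [i..<m - 1] @ [b])"
    and "x (m - 1) = b + 2 * int t1"
    and "x m = next_base (x (m - 1)) + 2 * int c2 + 2 * int t2"
  shows "(of_int (esym (int m - 1) (map x [1..<m + 1])) / of_int (\<Prod>j=1..m. x j) :: rat)
           = (\<Sum>j=1..m. 1 / of_int (x j))
         \<and> has_odd_greedy_expansion
           (of_int (esym (int m - 1) (map x [1..<m + 1])) / of_int (\<Prod>j=1..m. x j))
           (map x [1..<m + 1])"
proof -
  have b: "odd b" "b > 0"
    using assms(1,2,5) odd_next_base[of "x (m - 2)"] next_base_pos[of "x (m - 2)"] by auto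
  have x1: "odd (x (m - 1))" "x (m - 1) > 0" "b \<le> x (m - 1)"
    using b assms(7) by auto
  have xm: "odd (x m)" "x m > 0"
    using x1 assms(8) odd_next_base[of "x (m - 1)"] next_base_pos[of "x (m - 1)"] by auto
  have pos: "odd (x k) \<and> x k > 0" if "1 \<le> k" "k \<le> m" for k
  proof -
    consider "k \<le> m - 2" | "k = m - 1" | "k = m" using \<open>k \<le> m\<close> by linarith
    then show ?thesis using assms(2) that x1 xm by cases auto
  qed
  have tail: "(\<Sum>j=Suc i..m. 1 / of_int (x j)) < 2 / (of_int (x i) * (of_int (x i) - 2 :: rat))"
    if i: "1 \<le> i" "i \<le> m" and "x i \<ge> 3" for i
  proof -
    consider "i \<le> m - 2" | "i = m - 1" | "i = m" using \<open>i \<le> m\<close> by linarith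
    then show ?thesis
    proof cases
      case 1
      define zs where "zs = map x [Suc i..<m - 1]"
      have Cons: "map x [i..<m - 1] = x i # zs"
        using 1 assms(1) by (simp add: zs_def upt_conv_Cons)
      have nz: "0 \<notin> set zs"
      proof
        assume "0 \<in> set zs"
        then obtain k where "Suc i \<le> k" "k < m - 1" "x k = 0" by (auto simp: zs_def)
        then show False using assms(2)[of k] i by linarith
      qed
      have base: "(\<Sum>u\<leftarrow>zs. 1 / of_int u) < 2 / (of_int (x i) * (of_int (x i) - 2 :: rat))"
        unfolding zs_def
        by (rule tail_bound_induct) (use 1 i assms(1-3) \<open>x i \<ge> 3\<close> in auto)
      have bound_b: "(\<Sum>u\<leftarrow>zs. 1 / of_int u) + 1 / of_int b
          < 2 / (of_int (x i) * (of_int (x i) - 2 :: rat))"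
      \<comment> \<open>The hypothesis on \<open>c1\<close> stops at \<open>m - 3\<close>. For
        \<open>i = m - 2\<close> nothing lies between \<open>x i\<close> and \<open>b\<close>, and
        the choice of \<open>next_base\<close> gives the bound.\<close>
      proof (cases "i = m - 2")
        case True
        then have "zs = []" using assms(1) by (simp add: zs_def)
        then show ?thesis
          using tail_bound_next_base[of "x i" b] \<open>x i \<ge> 3\<close> True assms(5) by simp
      next
        case False
        then have "i \<le> m - 3" using 1 by linarith
        then have "B (x i # zs) < of_int b"
          using assms(4)[of i] i unfolding Cons assms(5) by blast
        then show ?thesis
          using tail_bound_extend[OF \<open>x i \<ge> 3\<close> nz _ _ base] b by simp
      qed
      \<comment> \<open>The hypothesis on \<open>c2\<close> concerns \<open>b\<close>, not
        \<open>x (m - 1)\<close>. The bound is therefore proved for a tail ending in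
        \<open>b\<close> and \<open>y\<close>; since \<open>b \<le> x (m - 1)\<close> and
        \<open>y \<le> x m\<close>, the actual tail is no larger.\<close>
      define y where "y = next_base b + 2 * int c2"
      have y: "y > 0" "y \<le> x m"
        using next_base_pos[of b] next_base_mono[of b "x (m - 1)"] b x1 assms(8)
        by (auto simp: y_def)
      have "B (x i # zs @ [b]) < of_int y"
        using assms(6)[OF i(1) 1] unfolding Cons y_def by simp
      then have "(\<Sum>u\<leftarrow>zs @ [b]. 1 / of_int u) + 1 / of_int y
          < 2 / (of_int (x i) * (of_int (x i) - 2 :: rat))"
        using bound_b b nz \<open>x i \<ge> 3\<close> y by (intro tail_bound_extend) auto
      moreover have "1 / of_int (x m) \<le> (1 / of_int y :: rat)"
        using y xm by (simp add: divide_left_mono)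
      moreover have "1 / of_int (x (m - 1)) \<le> (1 / of_int b :: rat)"
        using b x1 by (simp add: divide_left_mono)
      moreover have "(\<Sum>j=Suc i..m. 1 / of_int (x j) :: rat)
          = (\<Sum>u\<leftarrow>zs. 1 / of_int u) + 1 / of_int (x (m - 1)) + 1 / of_int (x m)"
      proof -
        obtain n where n: "m = Suc (Suc n)"
          using assms(1) by (intro that[of "m - 2"]) linarith
        have "(\<Sum>u\<leftarrow>zs. 1 / of_int u :: rat) = (\<Sum>j=Suc i..n. 1 / of_int (x j))"
          unfolding zs_def n map_map
          by (subst interv_sum_list_conv_sum_set_nat)
            (auto simp: atLeastLessThanSuc_atLeastAtMost simp del: upt_Suc)
        then show ?thesis using 1 n by simp
      qed
      ultimately show ?thesis by simp
    next
      case 2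
      \<comment> \<open>Here the tail is the single term \<open>1 / x m\<close>, and
        \<open>x m\<close> is at least \<open>next_base (x (m - 1))\<close>.\<close>
      then have "{Suc i..m} = {m}" using assms(1) by auto
      then show ?thesis
        using tail_bound_next_base[of "x i" "x m"] \<open>x i \<ge> 3\<close> 2 assms(8) by simp
    next
      case 3
      then show ?thesis using \<open>x i \<ge> 3\<close> by simp
    qed
  qed
  have "(of_int (esym (int m - 1) (map x [1..<m + 1])) / of_int (\<Prod>j=1..m. x j) :: rat)
      = (\<Sum>j=1..m. 1 / of_int (x j))"
  proof -
    have nz: "0 \<notin> set (map x [1..<m + 1])" using pos by fastforce
    have P: "prod_list (map x [1..<m + 1]) = (\<Prod>j=1..m. x j)"
      by (subst prod.distinct_set_conv_list[symmetric])
        (auto simp: atLeastLessThanSuc_atLeastAtMost simp del: upt_Suc)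
    have S: "(\<Sum>u\<leftarrow>map x [1..<m + 1]. 1 / of_int u :: rat) = (\<Sum>j=1..m. 1 / of_int (x j))"
      unfolding map_map
      by (subst interv_sum_list_conv_sum_set_nat)
        (auto simp: atLeastLessThanSuc_atLeastAtMost simp del: upt_Suc)
    have "(\<Prod>j=1..m. x j) \<noteq> 0" using P nz by (metis prod_list_zero_iff)
    then show ?thesis
      using of_int_esym_length_minus_one[OF nz, where 'a = rat] unfolding P S
      by (simp del: upt_Suc of_int_prod)
  qed
  moreover have "has_odd_greedy_expansion (\<Sum>j=1..m. 1 / of_int (x j)) (map x [1..<m + 1])"
    using assms(1) pos tail by (intro has_odd_greedy_expansion_if_tail_bounds) auto
  ultimately show ?thesis by simp
qed

end
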